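(* There exists a set $A\subset\mathbb{N}$ with $\mathrm{d}^*(A)>0$ with the following property. There do not exist an infinite set $B\subset\mathbb{N}$ and sequences $(t_k)_{k\in\mathbb{N}},(s_k)_{k\in\mathbb{N}}\subset\mathbb{N}$, at least one of which is bounded, such that $$\Big\{\sum_{n\in F} n \;:\; F\subset B+s_k\text{ with } 1\leq |F|\leq k\Big\}\subset A-t_k\quad\text{for every } k\in\mathbb{N}.$$
   Context: $\mathbb{N}=\{1,2,3,\dots\}$. The upper Banach density of $A\subset\mathbb{N}$ is $\mathrm{d}^*(A)=\limsup_{N-M\to\infty}\frac{|A\cap\{M,M+1,\ldots,N-1\}|}{N-M}$. For an integer $t$ and a set $S$ of integers, $S+t=\{s+t:s\in S\}$ and $S-t=\{s-t: s\in S\}$. *)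

theory Defs
  imports "HOL-Analysis.Analysis"
begin

text \<open>
  The positive integers are the subset \<open>{1..}\<close> of \<^typ>\<open>int\<close>, so that the translates
  \<open>S + t\<close> and \<open>S - t\<close> are formed in the integers, without truncated subtraction.

  The limit superior is taken along all pairs \<open>(M, N)\<close> with \<open>M \<ge> 1\<close>, as \<open>N - M\<close>
  tends to infinity; \<open>M\<close> itself is otherwise unconstrained.
\<close>

definition upper_Banach_density :: "int set \<Rightarrow> ereal" where
  "upper_Banach_density A =
     Limsup (inf (filtercomap (\<lambda>(M, N). N - M) at_top) (principal {(M, N). 1 \<le> M}))
       (\<lambda>(M, N). ereal (real (card (A \<inter> {M..<N})) / real_of_int (N - M)))"

lemma upper_Banach_density_eq_INF_SUP:
  "upper_Banach_density A =
     (INF L::int. SUP (M, N)\<in>{(M, N). 1 \<le> M \<and> L \<le> N - M}.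
        ereal (real (card (A \<inter> {M..<N})) / real_of_int (N - M)))"
proof -
  let ?F = "inf (filtercomap (\<lambda>(M, N). N - M) at_top) (principal {(M, N). (1::int) \<le> M})"
  let ?f = "\<lambda>(M, N). ereal (real (card (A \<inter> {M..<N})) / real_of_int (N - M))"
  have ev: "eventually P ?F \<longleftrightarrow> (\<exists>L. \<forall>M N. 1 \<le> M \<and> L \<le> N - M \<longrightarrow> P (M, N))" for P
    by (auto simp: eventually_inf_principal eventually_filtercomap_at_top_linorder)
  show ?thesis
    unfolding upper_Banach_density_def Limsup_def
  proof (rule antisym)
    show "(INF P\<in>{P. eventually P ?F}. SUP x\<in>Collect P. ?f x)
        \<le> (INF L. SUP x\<in>{(M, N). 1 \<le> M \<and> L \<le> N - M}. ?f x)"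
    proof (rule INF_greatest)
      fix L :: int
      have "eventually (\<lambda>(M, N). 1 \<le> M \<and> L \<le> N - M) ?F"
        unfolding ev by auto
      then show "(INF P\<in>{P. eventually P ?F}. SUP x\<in>Collect P. ?f x)
          \<le> (SUP x\<in>{(M, N). 1 \<le> M \<and> L \<le> N - M}. ?f x)"
        by (intro INF_lower) simp
    qed
    show "(INF L. SUP x\<in>{(M, N). 1 \<le> M \<and> L \<le> N - M}. ?f x)
        \<le> (INF P\<in>{P. eventually P ?F}. SUP x\<in>Collect P. ?f x)"
    proof (rule INF_greatest)
      fix P assume "P \<in> {P. eventually P ?F}"
      then obtain L where L: "\<forall>M N. 1 \<le> M \<and> L \<le> N - M \<longrightarrow> P (M, N)"
        unfolding mem_Collect_eq ev by blast
      have "(SUP x\<in>{(M, N). 1 \<le> M \<and> L \<le> N - M}. ?f x) \<le> (SUP x\<in>Collect P. ?f x)"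
        by (rule SUP_subset_mono) (use L in auto)
      then show "(INF L. SUP x\<in>{(M, N). 1 \<le> M \<and> L \<le> N - M}. ?f x) \<le> (SUP x\<in>Collect P. ?f x)"
        by (rule INF_lower2[OF UNIV_I])
    qed
  qed
qed

end

theory Submission
  imports Defs "HOL-Number_Theory.Cong"
begin

text \<open>
  Following Straus, remove from the positive integers, for every \<open>i \<ge> 0\<close>, the progression
  \<open>i + 2 ^ (i + 2) * j\<close> with \<open>j \<ge> 1\<close>; the removed density is at most \<open>1/2\<close>.

  If \<open>t\<close> is bounded, some value \<open>i\<close> of \<open>t\<close> is taken for infinitely many \<open>k\<close>. Summing
  \<open>2 ^ (i + 2)\<close> elements of \<open>B + s k\<close> that are congruent modulo \<open>2 ^ (i + 2)\<close> gives a multiple of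
  \<open>2 ^ (i + 2)\<close>, and its translate by \<open>i\<close> has been removed.

  If \<open>s\<close> is bounded, it may be taken constant and absorbed into \<open>B\<close>. If \<open>B\<close> accumulates 2-adically
  at \<open>0\<close>, already \<open>k = 1\<close> fails. Otherwise infinitely many elements of \<open>B\<close> are not divisible by
  some \<open>2 ^ v\<close>. The sums of at most \<open>k\<close> of these elements, for \<open>k\<close> large in terms of \<open>v\<close> only, then
  meet every class modulo \<open>2 ^ (2 ^ v + 2)\<close> of multiples of \<open>2 ^ v\<close>, so that their translate by any
  \<open>t\<close> meets the removed progression with \<open>i = t mod 2 ^ v\<close>.
\<close>

text \<open>The index \<open>j\<close> starts at 1 because \<open>j = 0\<close> would remove every
  \<open>i\<close>, and hence every positive integer.\<close>

definition straus_set :: "int set" where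
  "straus_set = {n. 1 \<le> n \<and> (\<forall>i j. 1 \<le> j \<longrightarrow> n \<noteq> int i + 2 ^ (i + 2) * j)}"

lemma not_in_straus_set:
  assumes "[n = int i] (mod 2 ^ (i + 2))" and "int i < n"
  shows "n \<notin> straus_set"
proof -
  from assms(1) obtain j where j: "n = int i + 2 ^ (i + 2) * j"
    by (metis cong_iff_lin cong_sym)
  with assms(2) have "0 < 2 ^ (i + 2) * j" by simp
  then have "1 \<le> j" by (simp add: zero_less_mult_iff)
  with j show ?thesis unfolding straus_set_def by blast
qed

text \<open>Only progressions with \<open>i \<le> N\<close> meet the interval, the one for
  \<open>i\<close> in at most \<open>N / 2 ^ (i + 2)\<close> points; the geometric series bounds the
  total by \<open>N / 2\<close>.\<close>

lemma card_removed_le: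
  fixes N :: nat
  shows "real (card ({1..int N} - straus_set)) \<le> real N / 2"
proof -
  let ?P = "\<lambda>i::nat. (\<lambda>j. int i + 2 ^ (i + 2) * j) ` {1..int N div 2 ^ (i + 2)}"
  have "{1..int N} - straus_set \<subseteq> (\<Union>i\<le>N. ?P i)"
  proof
    fix n assume n: "n \<in> {1..int N} - straus_set"
    then obtain i j where ij: "1 \<le> j" "n = int i + 2 ^ (i + 2) * j"
      unfolding straus_set_def by auto
    have "0 < 2 ^ (i + 2) * j" using ij by simp
    moreover have "n \<le> int N" using n by simp
    ultimately have "i \<le> N" using ij(2) by linarith
    moreover have "j * 2 ^ (i + 2) \<le> int N" using n ij(2) by (auto simp: mult.commute)
    then have "j \<le> int N div 2 ^ (i + 2)"
      using zdiv_mono1[of "j * 2 ^ (i + 2)" "int N" "2 ^ (i + 2)"] by simp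
    ultimately show "n \<in> (\<Union>i\<le>N. ?P i)" using ij by (intro UN_I[of i] image_eqI[of _ _ j]) auto
  qed
  then have "card ({1..int N} - straus_set) \<le> card (\<Union>i\<le>N. ?P i)"
    by (intro card_mono) auto
  also have "\<dots> \<le> (\<Sum>i\<le>N. card (?P i))" by (rule card_UN_le) simp
  also have "\<dots> \<le> (\<Sum>i\<le>N. nat (int N div 2 ^ (i + 2)))"
  proof (rule sum_mono)
    fix i show "card (?P i) \<le> nat (int N div 2 ^ (i + 2))"
      using card_image_le[of "{1..int N div 2 ^ (i + 2)}" "\<lambda>j. int i + 2 ^ (i + 2) * j"] by simp
  qed
  finally have "real (card ({1..int N} - straus_set))
      \<le> (\<Sum>i\<le>N. real (nat (int N div 2 ^ (i + 2))))"
    unfolding of_nat_sum[symmetric] by (rule of_nat_mono)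
  also have "\<dots> \<le> (\<Sum>i\<le>N. real N / 4 * (1 / 2) ^ i)"
  proof (rule sum_mono)
    fix i
    have "real (nat (int N div 2 ^ (i + 2))) = real_of_int (int N div 2 ^ (i + 2))"
      by (simp add: pos_imp_zdiv_nonneg_iff)
    also have "\<dots> \<le> real_of_int (int N) / real_of_int (2 ^ (i + 2))"
      by (rule real_of_int_div4)
    finally show "real (nat (int N div 2 ^ (i + 2))) \<le> real N / 4 * (1 / 2) ^ i"
      by (simp add: power_divide)
  qed
  also have "\<dots> = real N / 4 * (\<Sum>i\<le>N. (1 / 2) ^ i)" by (simp add: sum_distrib_left)
  also have "\<dots> \<le> real N / 4 * 2"
    by (rule mult_left_mono) (simp_all add: sum_gp0)
  finally show ?thesis by simp
qed

lemma upper_Banach_density_straus_set: "upper_Banach_density straus_set \<ge> ereal (1 / 2)"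
  unfolding upper_Banach_density_eq_INF_SUP
proof (rule INF_greatest)
  fix L :: int
  \<comment> \<open>\<open>L\<close> may be nonpositive; the maximum with 1 keeps the interval
    nonempty.\<close>
  define N where "N = nat (max L 1)"
  have N: "1 \<le> N" "L \<le> int N" unfolding N_def by auto
  have "{1..<int N + 1} = {1..int N}" by auto
  moreover have "card (straus_set \<inter> {1..int N}) + card ({1..int N} - straus_set) = N"
    using card_Int_Diff[of "{1..int N}" straus_set] by (simp add: Int_commute)
  ultimately have "real (card (straus_set \<inter> {1..<int N + 1})) \<ge> real N / 2"
    using card_removed_le[of N] by simp
  then have "ereal (1 / 2) \<le> (\<lambda>(M, N). ereal (real (card (straus_set \<inter> {M..<N})) / real_of_int (N - M)))
      (1, int N + 1)"
    using N by (simp add: field_simps)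
  also have "\<dots> \<le> (SUP (M, N)\<in>{(M, N). 1 \<le> M \<and> L \<le> N - M}.
        ereal (real (card (straus_set \<inter> {M..<N})) / real_of_int (N - M)))"
    by (rule SUP_upper) (use N in auto)
  finally show "ereal (1 / 2) \<le> \<dots>" .
qed

lemma infinite_residue_class:
  fixes B :: "int set"
  assumes "infinite B" and "0 < m"
  obtains c where "infinite {b \<in> B. [b = c] (mod m)}"
proof -
  have "finite ((\<lambda>b. b mod m) ` B)"
    by (rule finite_subset[of _ "{0..<m}"]) (use assms in auto)
  then obtain a where "a \<in> B" "infinite {b \<in> B. b mod m = a mod m}"
    using pigeonhole_infinite[OF assms(1)] by blast
  then show ?thesis using that[of a] by (simp add: cong_def)
qed

text \<open>All summands are positive, so one summand above \<open>L\<close> suffices. The bound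
  \<open>L\<close> supplies the inequality that \<open>not_in_straus_set\<close> requires.\<close>

lemma large_sum_in_class:
  fixes B :: "int set"
  assumes "infinite B" and "B \<subseteq> {1..}" and "\<And>b. b \<in> B \<Longrightarrow> [b = c] (mod m)" and "1 \<le> j"
  obtains F where "F \<subseteq> B" "card F = j" "L < \<Sum>F" "[\<Sum>F = int j * c] (mod m)"
proof -
  have "B \<subseteq> {1..L} \<union> {b \<in> B. L < b}" using assms(2) by auto
  then have "infinite {b \<in> B. L < b}"
    using assms(1) finite_subset by blast
  then obtain F where F: "F \<subseteq> {b \<in> B. L < b}" "card F = j" "finite F"
    using infinite_arbitrarily_large by metis
  with assms(4) obtain x where x: "x \<in> F" by fastforce
  have "x \<le> \<Sum>F" using F assms(2) by (intro member_le_sum[OF x]) force+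
  then have "L < \<Sum>F" using x F(1) by auto
  moreover have "[\<Sum>F = (\<Sum>b\<in>F. c)] (mod m)"
    by (rule cong_sum) (use F(1) assms(3) in auto)
  ultimately show ?thesis using that[of F] F by auto
qed

text \<open>The bound on \<open>card F\<close> depends on \<open>t\<close> but not on
  \<open>B\<close>, so it serves all the translates \<open>B + s k\<close> at once, even for
  unbounded \<open>s\<close>.\<close>

lemma sum_avoiding_fixed_translate:
  fixes B :: "int set"
  assumes "infinite B" and "B \<subseteq> {1..}" and "0 \<le> t"
  obtains F where "F \<subseteq> B" "1 \<le> card F" "card F \<le> 2 ^ (nat t + 2)" "\<Sum>F + t \<notin> straus_set"
proof -
  let ?m = "2 ^ (nat t + 2) :: int"
  obtain c where c: "infinite {b \<in> B. [b = c] (mod ?m)}"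
    using infinite_residue_class[OF assms(1), of ?m] by auto
  obtain F where F: "F \<subseteq> {b \<in> B. [b = c] (mod ?m)}" "card F = 2 ^ (nat t + 2)" "0 < \<Sum>F"
    "[\<Sum>F = int (2 ^ (nat t + 2)) * c] (mod ?m)"
    by (rule large_sum_in_class[OF c, of c ?m "2 ^ (nat t + 2)" 0]) (use assms(2) in auto)
  have "[\<Sum>F = 0] (mod ?m)" using F(4) by (simp add: cong_def)
  then have "[\<Sum>F + t = 0 + t] (mod ?m)" by (intro cong_add cong_refl)
  then have "\<Sum>F + t \<notin> straus_set"
    using F(3) assms(3) by (intro not_in_straus_set[of _ "nat t"]) auto
  with F show ?thesis by (intro that[of F]) auto
qed

text \<open>Here \<open>k\<close> is fixed before \<open>t\<close>, as needed when the sequence of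
  the \<open>t k\<close> is unbounded.\<close>

lemma sum_avoiding_all_translates:
  fixes B :: "int set"
  assumes B: "infinite B" "B \<subseteq> {1..}"
  obtains k :: nat where
    "\<forall>t\<ge>0. \<exists>F\<subseteq>B. 1 \<le> card F \<and> card F \<le> k \<and> \<Sum>F + t \<notin> straus_set"
proof (cases "\<forall>v::nat. infinite {b \<in> B. 2 ^ v dvd b}")
  case True
  have "\<exists>F\<subseteq>B. 1 \<le> card F \<and> card F \<le> 1 \<and> \<Sum>F + t \<notin> straus_set" if t: "0 \<le> t" for t
  proof -
    from True have "{b \<in> B. 2 ^ (nat t + 2) dvd b} \<noteq> {}" by (metis finite.emptyI)
    then obtain b where b: "b \<in> B" "2 ^ (nat t + 2) dvd b" by blast
    have "[b + t = 0 + t] (mod 2 ^ (nat t + 2))"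
      using b(2) by (intro cong_add cong_refl) (simp add: cong_0_iff)
    then have "b + t \<notin> straus_set"
      using b(1) B(2) t by (intro not_in_straus_set[of _ "nat t"]) auto
    then show ?thesis using b by (intro exI[of _ "{b}"]) auto
  qed
  then show ?thesis using that[of 1] by blast
next
  case False
  then obtain v :: nat where v: "finite {b \<in> B. 2 ^ v dvd b}" by blast
  have "infinite (B - {b \<in> B. 2 ^ v dvd b})" using B(1) v by simp
  \<comment> \<open>Every residue \<open>i < 2 ^ v\<close> satisfies \<open>i + 2 \<le> e\<close>,
    so a single modulus serves all \<open>t\<close>.\<close>
  define e :: nat where "e = 2 ^ v + 2"
  let ?m = "2 ^ e :: int"
  obtain c where c: "infinite {b \<in> B - {b \<in> B. 2 ^ v dvd b}. [b = c] (mod ?m)}" (is "infinite ?C")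
    using infinite_residue_class[OF \<open>infinite (B - _)\<close>, of ?m] by auto
  have "v \<le> e" unfolding e_def using less_exp[of v] by linarith
  then have vm: "(2::int) ^ v dvd ?m" by (rule le_imp_power_dvd)
  obtain b where "b \<in> ?C" using c by (metis ex_in_conv finite.emptyI)
  then have nd: "\<not> 2 ^ v dvd c" using cong_dvd_iff[OF cong_dvd_modulus[OF _ vm]] by blast
  \<comment> \<open>Since \<open>2 ^ v\<close> does not divide \<open>c\<close>, this gcd divides
    \<open>2 ^ v\<close>, so multiples of \<open>c\<close> reach every multiple of
    \<open>2 ^ v\<close> modulo \<open>2 ^ e\<close>.\<close>
  obtain w where w: "w \<le> e" "gcd c ?m = 2 ^ w"
    by (rule divides_primepow[of "2::int" "gcd c ?m" e]) auto
  have "w \<le> v"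
  proof (rule ccontr)
    assume "\<not> w \<le> v"
    then have "(2::int) ^ v dvd 2 ^ w" by (intro le_imp_power_dvd) simp
    with nd w(2) show False by (metis dvd_trans gcd_dvd1)
  qed
  have "\<exists>F\<subseteq>B. 1 \<le> card F \<and> card F \<le> 2 ^ e \<and> \<Sum>F + t \<notin> straus_set" if t: "0 \<le> t" for t
  proof -
    \<comment> \<open>This choice makes \<open>int i - t\<close> a multiple of \<open>2 ^ v\<close>,
      hence \<open>c * x = int i - t\<close> solvable modulo \<open>2 ^ e\<close>.\<close>
    define i where "i = nat (t mod 2 ^ v)"
    have i: "int i = t mod 2 ^ v" unfolding i_def by simp
    have "t mod 2 ^ v < 2 ^ v" by simp
    then have "int i < int (2 ^ v)" unfolding i by simp
    then have ie: "i + 2 \<le> e" unfolding e_def by linarith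
    have "2 ^ v dvd int i - t" unfolding i by (simp add: mod_eq_dvd_iff[symmetric])
    moreover have "(2::int) ^ w dvd 2 ^ v" using \<open>w \<le> v\<close> by (rule le_imp_power_dvd)
    ultimately have "gcd c ?m dvd int i - t" using w(2) by (metis dvd_trans)
    then obtain x where x: "[c * x = int i - t] (mod ?m)"
      using cong_solve_dvd_int by blast
    \<comment> \<open>The representative of \<open>x\<close> is taken in \<open>{1..2 ^ e}\<close>, since empty sums are not allowed.\<close>
    define j where "j = nat ((x - 1) mod ?m) + 1"
    have ij: "int j = (x - 1) mod ?m + 1" unfolding j_def by simp
    have "(x - 1) mod ?m < ?m" by simp
    then have "int j \<le> int (2 ^ e)" unfolding ij by (simp only: of_nat_power of_nat_numeral zless_imp_add1_zle)
    then have j: "1 \<le> j" "j \<le> 2 ^ e" unfolding j_def by (simp, linarith)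
    have "[int j = (x - 1) + 1] (mod ?m)" unfolding ij by (intro cong_add cong_refl) simp
    then have jx: "[int j * c = x * c] (mod ?m)" by (intro cong_mult cong_refl) simp
    obtain F where F: "F \<subseteq> ?C" "card F = j" "int i < \<Sum>F" "[\<Sum>F = int j * c] (mod ?m)"
      by (rule large_sum_in_class[OF c, of c ?m j "int i"]) (use B(2) j in auto)
    have "[\<Sum>F = int i - t] (mod ?m)"
      using F(4) jx x by (metis cong_trans mult.commute)
    then have "[\<Sum>F + t = int i - t + t] (mod ?m)" by (intro cong_add cong_refl)
    then have "[\<Sum>F + t = int i] (mod ?m)" by simp
    then have "[\<Sum>F + t = int i] (mod 2 ^ (i + 2))"
      by (rule cong_dvd_modulus) (use ie in \<open>rule le_imp_power_dvd\<close>)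
    then have "\<Sum>F + t \<notin> straus_set" using F(3) t by (intro not_in_straus_set) auto
    then show ?thesis using F j by (intro exI[of _ F]) auto
  qed
  then show ?thesis using that[of "2 ^ e"] by blast
qed

lemma bounded_sequence_frequent_value:
  fixes f :: "nat \<Rightarrow> int"
  assumes "f ` {1..} \<subseteq> {1..}" and "bdd_above (f ` {1..})"
  obtains a where "1 \<le> a" "\<forall>k. \<exists>n\<ge>k. 1 \<le> n \<and> f n = a"
proof -
  from assms(2) obtain u where u: "\<And>x. x \<in> f ` {1..} \<Longrightarrow> x \<le> u" by (auto simp: bdd_above_def)
  have "f ` {1..} \<subseteq> {1..u}" using u assms(1) by auto
  then have "finite (f ` {1..})" using finite_subset by blast
  then obtain m where m: "m \<in> {1..}" "infinite {n \<in> {1..}. f n = f m}"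
    using pigeonhole_infinite[OF infinite_Ici] by blast
  show ?thesis
  proof (rule that[of "f m"])
    show "1 \<le> f m" using m(1) assms(1) by auto
    show "\<forall>k. \<exists>n\<ge>k. 1 \<le> n \<and> f n = f m"
      using m(2) unfolding infinite_nat_iff_unbounded_le by force
  qed
qed

theorem proposition2p4:
  shows "\<exists>A :: int set. A \<subseteq> {1..} \<and> upper_Banach_density A > 0 \<and>
    \<not> (\<exists>(B :: int set) (t :: nat \<Rightarrow> int) (s :: nat \<Rightarrow> int).
         B \<subseteq> {1..} \<and> infinite B \<and> t ` {1..} \<subseteq> {1..} \<and> s ` {1..} \<subseteq> {1..} \<and>
         (bdd_above (t ` {1..}) \<or> bdd_above (s ` {1..})) \<and>
         (\<forall>k\<ge>1. {\<Sum>n\<in>F. n | F. F \<subseteq> (\<lambda>b. b + s k) ` B \<and> 1 \<le> card F \<and> card F \<le> k}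
                   \<subseteq> (\<lambda>a. a - t k) ` A))"
proof (intro exI[of _ straus_set] conjI notI)
  show "straus_set \<subseteq> {1..}" unfolding straus_set_def by auto
  have "(0::ereal) < ereal (1 / 2)" by simp
  then show "upper_Banach_density straus_set > 0"
    using upper_Banach_density_straus_set by (rule less_le_trans)
next
  assume "\<exists>(B :: int set) (t :: nat \<Rightarrow> int) (s :: nat \<Rightarrow> int).
         B \<subseteq> {1..} \<and> infinite B \<and> t ` {1..} \<subseteq> {1..} \<and> s ` {1..} \<subseteq> {1..} \<and>
         (bdd_above (t ` {1..}) \<or> bdd_above (s ` {1..})) \<and>
         (\<forall>k\<ge>1. {\<Sum>n\<in>F. n | F. F \<subseteq> (\<lambda>b. b + s k) ` B \<and> 1 \<le> card F \<and> card F \<le> k}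
                   \<subseteq> (\<lambda>a. a - t k) ` straus_set)"
  then obtain B :: "int set" and t s :: "nat \<Rightarrow> int" where
    B: "B \<subseteq> {1..}" "infinite B" and t: "t ` {1..} \<subseteq> {1..}" and s: "s ` {1..} \<subseteq> {1..}" and
    bdd: "bdd_above (t ` {1..}) \<or> bdd_above (s ` {1..})" and
    *: "\<forall>k\<ge>1. {\<Sum>n\<in>F. n | F. F \<subseteq> (\<lambda>b. b + s k) ` B \<and> 1 \<le> card F \<and> card F \<le> k}
                   \<subseteq> (\<lambda>a. a - t k) ` straus_set"
    by (elim exE conjE) (rule that)
  have sums: "\<Sum>F + t k \<in> straus_set"
    if "1 \<le> k" "F \<subseteq> (\<lambda>b. b + s k) ` B" "1 \<le> card F" "card F \<le> k" for k F
  proof -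
    have "\<Sum>F \<in> (\<lambda>a. a - t k) ` straus_set" using * that by blast
    then show ?thesis by auto
  qed
  have shift: "infinite ((\<lambda>b. b + a) ` B)" "(\<lambda>b. b + a) ` B \<subseteq> {1..}" if "1 \<le> a" for a
    using B that by (auto simp: finite_image_iff)
  from bdd show False
  proof
    assume "bdd_above (t ` {1..})"
    with t obtain a where a: "1 \<le> a" "\<forall>k. \<exists>n\<ge>k. 1 \<le> n \<and> t n = a"
      by (rule bounded_sequence_frequent_value)
    \<comment> \<open>The index is large enough to admit all sums of up to
      \<open>2 ^ (nat a + 2)\<close> elements.\<close>
    obtain n where n: "2 ^ (nat a + 2) \<le> n" "1 \<le> n" "t n = a" using a(2) by blast
    have "1 \<le> s n" using s n(2) by auto
    moreover have "0 \<le> a" using a(1) by simp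
    ultimately obtain F where "F \<subseteq> (\<lambda>b. b + s n) ` B" "1 \<le> card F"
      "card F \<le> 2 ^ (nat a + 2)" "\<Sum>F + a \<notin> straus_set"
      using sum_avoiding_fixed_translate[OF shift] by metis
    with sums[of n F] n show False by auto
  next
    assume "bdd_above (s ` {1..})"
    with s obtain a where a: "1 \<le> a" "\<forall>k. \<exists>n\<ge>k. 1 \<le> n \<and> s n = a"
      by (rule bounded_sequence_frequent_value)
    from shift[OF a(1)] obtain k where
      k: "\<forall>t\<ge>0. \<exists>F\<subseteq>(\<lambda>b. b + a) ` B. 1 \<le> card F \<and> card F \<le> k \<and> \<Sum>F + t \<notin> straus_set"
      by (rule sum_avoiding_all_translates)
    \<comment> \<open>The bound \<open>k\<close> depends only on \<open>B\<close> and
      \<open>a\<close>, so \<open>n\<close> can be chosen after it, whatever \<open>t n\<close>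
      is.\<close>
    obtain n where n: "k \<le> n" "1 \<le> n" "s n = a" using a(2) by blast
    have "0 \<le> t n" using t n(2) by force
    with k obtain F where "F \<subseteq> (\<lambda>b. b + a) ` B" "1 \<le> card F" "card F \<le> k"
      "\<Sum>F + t n \<notin> straus_set" by blast
    with sums[of n F] n show False by auto
  qed
qed

end
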